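(* Let $G$ be a connected graph with $n$ vertices. Then $$BH(G)\leq \left(\frac{1}{\lambda_2}+\frac{1}{\lambda_n}\right)Kf(G)-n(n-1)\frac{1}{\lambda_2\lambda_n}$$ with equality if and only if for some $r\in \{2,\ldots,n\}$, $\lambda_2=\cdots=\lambda_r$ and $\lambda_{r+1}=\cdots=\lambda_n$.
   Context: For a graph $G$ on $n$ vertices, $L(G)=D(G)-A(G)$ is its Laplacian matrix with eigenvalues $0=\lambda_1\le\lambda_2\le\cdots\le\lambda_n$ (for connected $G$ with $n\ge2$, $\lambda_2>0$). The biharmonic index is $BH(G)=\frac12\sum_{u,v\in V(G)}d_B^2(u,v)$ with $d_B^2$ the squared biharmonic distance; equivalently $BH(G)=n\sum_{i=2}^n\lambda_i^{-2}$. The Kirchhoff index $Kf(G)$ is the sum of resistance distances over all unordered pairs of vertices; equivalently $Kf(G)=n\sum_{i=2}^n\lambda_i^{-1}$. *)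

theory Defs
  imports
    "HOL-Analysis.Analysis"
    "HOL-Computational_Algebra.Computational_Algebra"
    "Graph_Theory.Digraph_Component"
begin

text \<open>
  Finite simple graphs are the symmetric loop-free digraphs without parallel arcs of
  \<^locale>\<open>Digraph.graph\<close>: an edge is a pair of opposite arcs, so the degree of a vertex is its
  out-degree. Matrices are indexed by the vertices themselves, so these definitions are meant
  for graphs whose vertex set is the whole (finite) type.
\<close>

definition adjacency_matrix :: "('v::finite, 'e) pre_digraph \<Rightarrow> real^'v^'v" where
  "adjacency_matrix G = (\<chi> u v. if (u, v) \<in> arcs_ends G then 1 else 0)"

definition degree_matrix :: "('v::finite, 'e) pre_digraph \<Rightarrow> real^'v^'v" where
  "degree_matrix G = (\<chi> u v. if u = v then real (out_degree G u) else 0)"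

definition laplacian :: "('v::finite, 'e) pre_digraph \<Rightarrow> real^'v^'v" where
  "laplacian G = degree_matrix G - adjacency_matrix G"

definition charpoly :: "'a::comm_ring_1^'n^'n \<Rightarrow> 'a poly" where
  "charpoly A = det (\<chi> i j. (if i = j then [:0, 1:] else 0) - [:A $ i $ j:])"

text \<open>
  The \<open>i\<close>-th smallest Laplacian eigenvalue, counted with multiplicity and numbered from 1.
  The Laplacian is a symmetric real matrix, so all roots of its characteristic polynomial are
  real and the list has as many entries as there are vertices.
\<close>
definition laplacian_eigenvalue :: "('v::finite, 'e) pre_digraph \<Rightarrow> nat \<Rightarrow> real" where
  "laplacian_eigenvalue G i =
     sorted_list_of_multiset (proots (charpoly (laplacian G))) ! (i - 1)"

text \<open>The Moore--Penrose inverse, characterised uniquely by the four Penrose equations.\<close>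
definition pinv :: "real^'n^'m \<Rightarrow> real^'m^'n" where
  "pinv A = (THE X. A ** X ** A = A \<and> X ** A ** X = X \<and>
     transpose (A ** X) = A ** X \<and> transpose (X ** A) = X ** A)"

definition resistance_distance :: "('v::finite, 'e) pre_digraph \<Rightarrow> 'v \<Rightarrow> 'v \<Rightarrow> real" where
  "resistance_distance G u v =
     (let P = pinv (laplacian G) in P $ u $ u + P $ v $ v - 2 * P $ u $ v)"

definition biharmonic_distance :: "('v::finite, 'e) pre_digraph \<Rightarrow> 'v \<Rightarrow> 'v \<Rightarrow> real" where
  "biharmonic_distance G u v =
     (let Q = pinv (laplacian G) ** pinv (laplacian G)
      in sqrt (Q $ u $ u + Q $ v $ v - 2 * Q $ u $ v))"

text \<open>
  Both sums run over ordered pairs; the factor 1/2 makes each unordered pair count once,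
  the diagonal terms being 0.
\<close>
definition kirchhoff_index :: "('v::finite, 'e) pre_digraph \<Rightarrow> real" where
  "kirchhoff_index G = 1 / 2 * (\<Sum>u\<in>UNIV. \<Sum>v\<in>UNIV. resistance_distance G u v)"

definition biharmonic_index :: "('v::finite, 'e) pre_digraph \<Rightarrow> real" where
  "biharmonic_index G = 1 / 2 * (\<Sum>u\<in>UNIV. \<Sum>v\<in>UNIV. (biharmonic_distance G u v)\<^sup>2)"

end

theory Submission
  imports Defs
begin

text \<open>
  In an orthonormal eigenbasis of the Laplacian the pseudoinverse is diagonal with entries
  \<open>inverse l\<close>, where Isabelle's convention \<open>inverse 0 = 0\<close> is exactly what the Penrose equations
  ask for. Since the all-ones vector spans the kernel, summing the distances leaves only traces:
  the Kirchhoff and biharmonic indices are \<open>n\<close> times the sums of the inverse nonzero eigenvalues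
  and of their squares. The inequality is then the sum over \<open>i\<close> of
  \<open>(1 / \<lambda>\<^sub>2 - 1 / \<lambda>\<^sub>i) * (1 / \<lambda>\<^sub>i - 1 / \<lambda>\<^sub>n) \<ge> 0\<close>.
\<close>

no_notation fps_nth (infixl "$" 75)

section \<open>The spectral theorem\<close>

text \<open>A maximiser of the quadratic form on the compact unit sphere of \<open>S\<close> is an
  eigenvector: otherwise moving along the residual \<open>c *\<^sub>R e - f e\<close> would push the
  Rayleigh quotient above its maximum \<open>c\<close>.\<close>

lemma selfadjoint_eigenvector:
  fixes f :: "'a::euclidean_space \<Rightarrow> 'a"
  assumes f: "linear f" and adj: "\<And>x y. inner (f x) y = inner x (f y)"
    and S: "subspace S" and inv: "\<And>x. x \<in> S \<Longrightarrow> f x \<in> S" and "S \<noteq> {0}"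
  obtains e c where "e \<in> S" "norm e = 1" "f e = c *\<^sub>R e"
proof -
  let ?K = "S \<inter> sphere 0 1"
  have "compact ?K"
    using closed_subspace[OF S] by (simp add: closed_Int_compact)
  moreover obtain x where x: "x \<in> S" "x \<noteq> 0"
    using \<open>S \<noteq> {0}\<close> subspace_0[OF S] by auto
  then have "x /\<^sub>R norm x \<in> ?K"
    using S by (simp add: subspace_scale)
  moreover have "continuous_on ?K (\<lambda>x. inner x (f x))"
    using f by (intro continuous_intros linear_continuous_on) (simp add: linear_conv_bounded_linear)
  ultimately obtain e where e: "e \<in> ?K" and max: "\<And>y. y \<in> ?K \<Longrightarrow> inner y (f y) \<le> inner e (f e)"
    using continuous_attains_sup[of ?K "\<lambda>x. inner x (f x)"] by blast
  define c where "c = inner e (f e)"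
  have eS: "e \<in> S" and ne: "norm e = 1" using e by auto
  \<comment> \<open>By homogeneity, maximality of \<open>c\<close> on the sphere says
    \<open>g\<close> is nonnegative on all of \<open>S\<close>; it vanishes at
    \<open>e\<close>.\<close>
  define g where "g y = c * inner y y - inner y (f y)" for y
  have g_nonneg: "g y \<ge> 0" if "y \<in> S" for y
  proof (cases "y = 0")
    case False
    have "y /\<^sub>R norm y \<in> ?K" using that S False by (simp add: subspace_scale)
    from max[OF this] have "inner y (f y) / (norm y)\<^sup>2 \<le> c"
      using linear_scale[OF f] by (simp add: c_def field_simps power2_eq_square)
    then show ?thesis
      using False by (simp add: g_def field_simps power2_norm_eq_inner)
  qed (simp add: g_def)
  \<comment> \<open>Half the gradient of \<open>g\<close> at \<open>e\<close>, so the linear term of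
    \<open>g\<close> along \<open>y\<close> is twice the squared norm of \<open>y\<close>.\<close>
  define y where "y = c *\<^sub>R e - f e"
  have yS: "y \<in> S" using S inv eS by (simp add: y_def subspace_diff subspace_scale)
  have expand: "g (e + t *\<^sub>R y) = 2 * t * inner y y + t\<^sup>2 * g y" for t
  proof -
    have "g (e + t *\<^sub>R y) = (c * inner e e - inner e (f e)) + 2 * t * (c * inner e y - inner y (f e)) + t\<^sup>2 * g y"
      using adj[of e y] unfolding g_def
      by (simp add: linear_add[OF f] linear_scale[OF f] inner_add_left inner_add_right
          inner_commute power2_eq_square algebra_simps)
    moreover have "inner e e = 1" using ne by (simp add: dot_square_norm)
    moreover have "c * inner e y - inner y (f e) = inner y y"
      by (subst (4) y_def) (simp add: inner_diff_right inner_commute)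
    ultimately show ?thesis by (simp add: c_def)
  qed
  have "inner y y = 0"
  proof (rule ccontr)
    assume "inner y y \<noteq> 0"
    then have pos: "inner y y > 0" by (simp add: order_less_le)
    have gy: "g y \<ge> 0" using g_nonneg yS by blast
    \<comment> \<open>A small negative step makes the linear term dominate the quadratic one. The
      minimiser would divide by \<open>g y\<close>; adding 1 also covers
      \<open>g y = 0\<close>.\<close>
    define t where "t = - inner y y / (g y + 1)"
    have "0 \<le> g (e + t *\<^sub>R y)"
      using S eS yS by (intro g_nonneg) (simp add: subspace_add subspace_scale)
    also have "\<dots> = - (inner y y)\<^sup>2 * (g y + 2) / (g y + 1)\<^sup>2"
      using gy unfolding expand t_def by (simp add: divide_simps) (simp add: algebra_simps power2_eq_square)
    also have "\<dots> < 0" using pos gy by (simp add: divide_neg_pos)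
    finally show False by simp
  qed
  then have "f e = c *\<^sub>R e" by (simp add: y_def)
  with eS ne that show ?thesis by blast
qed

text \<open>Induction on dimension, stated for invariant subspaces: after splitting off one unit
  eigenvector, its orthogonal complement in \<open>S\<close> is again invariant because
  \<open>f\<close> is self-adjoint.\<close>

lemma selfadjoint_orthonormal_eigenbasis:
  fixes f :: "'a::euclidean_space \<Rightarrow> 'a"
  assumes f: "linear f" and adj: "\<And>x y. inner (f x) y = inner x (f y)"
    and S: "subspace S" and inv: "\<And>x. x \<in> S \<Longrightarrow> f x \<in> S"
  shows "\<exists>B\<subseteq>S. finite B \<and> card B = dim S \<and> pairwise orthogonal B \<and>
           (\<forall>b\<in>B. norm b = 1 \<and> (\<exists>c. f b = c *\<^sub>R b))"
  using S inv
proof (induction "dim S" arbitrary: S)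
  case 0
  then show ?case by (intro exI[of _ "{}"]) auto
next
  case (Suc d)
  then have "S \<noteq> {0}" by auto
  then obtain e c where e: "e \<in> S" "norm e = 1" "f e = c *\<^sub>R e"
    using selfadjoint_eigenvector[OF f adj Suc.prems(1) Suc.prems(2)] by blast
  define T where "T = {y \<in> S. orthogonal e y}"
  have T: "subspace T"
    using subspace_inter[OF Suc.prems(1) subspace_orthogonal_to_vector[of e]]
    by (simp add: T_def Collect_conj_eq)
  have "e \<noteq> 0" using e by auto
  \<comment> \<open>This form of \<open>T\<close> matches the dimension formula for orthogonal
    complements, which gives codimension one.\<close>
  have "T = {y \<in> S. \<forall>x\<in>span {e}. orthogonal x y}"
    by (auto simp: T_def orthogonal_def span_singleton)
  then have "dim T + dim {e} = dim S"
    using dim_subspace_orthogonal_to_vectors[of "span {e}" S] Suc.prems(1) e(1)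
    by (simp add: span_minimal)
  then have "d = dim T" using \<open>Suc d = dim S\<close> \<open>e \<noteq> 0\<close> by simp
  moreover have "f y \<in> T" if "y \<in> T" for y
    using that Suc.prems(2) adj[of e y] e by (auto simp: T_def orthogonal_def)
  ultimately obtain B where B: "B \<subseteq> T" "finite B" "card B = dim T" "pairwise orthogonal B"
    "\<forall>b\<in>B. norm b = 1 \<and> (\<exists>c. f b = c *\<^sub>R b)"
    using Suc.hyps(1)[of T] T by blast
  have "e \<notin> B" using B(1) \<open>e \<noteq> 0\<close> by (auto simp: T_def orthogonal_def)
  then have "card (insert e B) = dim S"
    using B \<open>d = dim T\<close> \<open>Suc d = dim S\<close> by simp
  moreover have "pairwise orthogonal (insert e B)"
    using B(1,4) by (auto simp: pairwise_insert T_def orthogonal_commute)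
  ultimately show ?case
    using B e by (intro exI[of _ "insert e B"]) (auto simp: T_def)
qed

section \<open>Calculus of orthogonally diagonalised matrices\<close>

definition diag_matrix :: "('n \<Rightarrow> real) \<Rightarrow> real^'n^'n" where
  "diag_matrix l = (\<chi> i j. if i = j then l i else 0)"

text \<open>For orthogonal \<open>P\<close>, column \<open>k\<close> is an eigenvector with
  eigenvalue \<open>l k\<close>. The eigenvalues are an unordered family, so products and
  pseudoinverses can be computed pointwise on \<open>l\<close>; sorting is postponed.\<close>

definition spectral_matrix :: "real^'n^'n \<Rightarrow> ('n \<Rightarrow> real) \<Rightarrow> real^'n^'n" where
  "spectral_matrix P l = P ** diag_matrix l ** transpose P"

lemma diag_matrix_mult: "diag_matrix a ** diag_matrix b = diag_matrix (\<lambda>i. a i * b i)"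
  by (simp add: vec_eq_iff diag_matrix_def matrix_matrix_mult_def mult_delta_left mult_delta_right)

lemma diag_matrix_mult_vector: "(diag_matrix l *v x) $ i = l i * x $ i"
  by (simp add: diag_matrix_def matrix_vector_mult_def mult_delta_left)

lemma trace_diag_matrix: "trace (diag_matrix l) = sum l UNIV"
  by (simp add: trace_def diag_matrix_def)

lemma spectral_matrix_nth: "spectral_matrix P l $ i $ j = (\<Sum>k\<in>UNIV. P $ i $ k * l k * P $ j $ k)"
  by (simp add: spectral_matrix_def diag_matrix_def matrix_matrix_mult_def transpose_def mult_delta_left mult_delta_right)

lemma transpose_spectral_matrix: "transpose (spectral_matrix P l) = spectral_matrix P l"
  by (simp add: vec_eq_iff transpose_def spectral_matrix_nth mult.commute mult.left_commute)

lemma spectral_matrix_mult: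
  assumes "orthogonal_matrix P"
  shows "spectral_matrix P a ** spectral_matrix P b = spectral_matrix P (\<lambda>i. a i * b i)"
proof -
  have "spectral_matrix P a ** spectral_matrix P b
      = P ** diag_matrix a ** (transpose P ** P) ** diag_matrix b ** transpose P"
    by (simp only: spectral_matrix_def matrix_mul_assoc)
  also have "\<dots> = P ** (diag_matrix a ** diag_matrix b) ** transpose P"
    using assms by (simp add: orthogonal_matrix_def matrix_mul_assoc)
  finally show ?thesis by (simp add: diag_matrix_mult spectral_matrix_def)
qed

lemma trace_spectral_matrix:
  assumes "orthogonal_matrix P"
  shows "trace (spectral_matrix P l) = sum l UNIV"
proof -
  have "trace (spectral_matrix P l) = trace (transpose P ** (P ** diag_matrix l))"
    unfolding spectral_matrix_def by (rule trace_mul_sym)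
  also have "\<dots> = trace (diag_matrix l)"
    using assms by (simp add: orthogonal_matrix_def matrix_mul_assoc)
  finally show ?thesis by (simp add: trace_diag_matrix)
qed

lemma spectral_matrix_mult_column:
  assumes "orthogonal_matrix P"
  shows "spectral_matrix P l *v column k P = l k *\<^sub>R column k P"
proof -
  have "spectral_matrix P l *v column k P = (spectral_matrix P l ** P) *v axis k 1"
    by (simp add: matrix_vector_mul_assoc flip: matrix_vector_mult_basis)
  also have "spectral_matrix P l ** P = P ** diag_matrix l ** (transpose P ** P)"
    by (simp only: spectral_matrix_def matrix_mul_assoc)
  also have "\<dots> = P ** diag_matrix l"
    using assms by (simp add: orthogonal_matrix_def)
  also have "(P ** diag_matrix l) *v axis k 1 = P *v (diag_matrix l *v axis k 1)"
    by (simp add: matrix_vector_mul_assoc)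
  also have "diag_matrix l *v axis k 1 = l k *\<^sub>R axis k 1"
    by (simp add: vec_eq_iff diag_matrix_mult_vector axis_def)
  finally show ?thesis
    by (simp add: matrix_vector_mult_scaleR matrix_vector_mult_basis)
qed

theorem symmetric_matrix_spectral:
  fixes A :: "real^'n^'n"
  assumes "transpose A = A"
  obtains P l where "orthogonal_matrix P" "A = spectral_matrix P l"
proof -
  have "\<exists>B\<subseteq>(UNIV :: (real^'n) set). finite B \<and> card B = dim (UNIV :: (real^'n) set) \<and> pairwise orthogonal B \<and>
           (\<forall>b\<in>B. norm b = 1 \<and> (\<exists>c. A *v b = c *\<^sub>R b))"
    using assms
    by (intro selfadjoint_orthonormal_eigenbasis)
      (simp_all, metis dot_lmul_matrix vector_transpose_matrix)
  then obtain B :: "(real^'n) set" where B: "finite B" "card B = CARD('n)" "pairwise orthogonal B"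
    "\<forall>b\<in>B. norm b = 1 \<and> (\<exists>c. A *v b = c *\<^sub>R b)" by auto
  \<comment> \<open>The eigenbasis has as many elements as the index type, so its vectors can serve
    as the columns of a square matrix.\<close>
  then obtain q where q: "bij_betw q (UNIV :: 'n set) B"
    using finite_same_card_bij[of "UNIV :: 'n set" B] by auto
  have qB: "q i \<in> B" for i using q by (auto simp: bij_betw_def)
  have "\<forall>i. \<exists>c. A *v q i = c *\<^sub>R q i" using B(4) qB by blast
  then obtain l where l: "\<And>i. A *v q i = l i *\<^sub>R q i"
    unfolding choice_iff by blast
  define P :: "real^'n^'n" where "P = (\<chi> i j. q j $ i)"
  have col: "column i P = q i" for i by (simp add: P_def column_def vec_eq_iff)
  have P: "orthogonal_matrix P"
    using B(3,4) qB bij_betw_imp_inj_on[OF q] unfolding orthogonal_matrix_orthonormal_columns col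
    by (metis injD pairwiseD)
  have "A ** P = P ** diag_matrix l"
  proof -
    have "(A ** P) $ i $ j = (P ** diag_matrix l) $ i $ j" for i j
    proof -
      have "(A ** P) $ i $ j = (A *v q j) $ i"
        by (simp add: matrix_matrix_mult_def matrix_vector_mult_def P_def)
      also have "\<dots> = (P ** diag_matrix l) $ i $ j"
        by (simp add: l matrix_matrix_mult_def diag_matrix_def P_def mult_delta_left mult_delta_right)
      finally show ?thesis .
    qed
    then show ?thesis by (simp add: vec_eq_iff)
  qed
  then have "A ** (P ** transpose P) = spectral_matrix P l"
    by (simp add: spectral_matrix_def matrix_mul_assoc)
  then have "A = spectral_matrix P l"
    using P by (simp add: orthogonal_matrix_def)
  with P that show ?thesis by blast
qed

section \<open>Characteristic polynomial and multiset of eigenvalues\<close>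

lemma poly_charpoly: "poly (charpoly A) x = det (x *\<^sub>R mat 1 - A)"
  for A :: "real^'n^'n"
  unfolding charpoly_def det_def
  by (simp add: poly_sum poly_prod mat_def if_distrib[of "\<lambda>p. poly p x"] mult_delta_right cong: if_cong)

text \<open>Real polynomials agreeing at every point are equal. At \<open>x\<close>, subtracting
  from \<open>x\<close> times the identity only changes the diagonal factor to
  \<open>x - l k\<close>, and the two outer determinants multiply to 1.\<close>

lemma charpoly_spectral_matrix:
  assumes "orthogonal_matrix P"
  shows "charpoly (spectral_matrix P l) = (\<Prod>k\<in>UNIV. [:- l k, 1:])"
proof -
  have PP: "P ** transpose P = mat 1" "det P * det P = 1"
    using assms det_orthogonal_matrix[OF assms] by (auto simp: orthogonal_matrix_def)
  have "poly (charpoly (spectral_matrix P l)) x = poly (\<Prod>k\<in>UNIV. [:- l k, 1:]) x" for x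
  proof -
    have "x *\<^sub>R mat 1 - spectral_matrix P l = spectral_matrix P (\<lambda>k. x - l k)"
    proof -
      have "mat 1 $ i $ j = (\<Sum>k\<in>UNIV. P $ i $ k * P $ j $ k)" for i j
        unfolding PP(1)[symmetric] by (simp add: matrix_matrix_mult_def transpose_def)
      then show ?thesis
        by (simp add: vec_eq_iff spectral_matrix_nth sum_distrib_left algebra_simps flip: sum_subtractf)
    qed
    then have "poly (charpoly (spectral_matrix P l)) x = det (diag_matrix (\<lambda>k. x - l k))"
      using PP(2) by (simp add: poly_charpoly spectral_matrix_def det_mul det_transpose)
    also have "\<dots> = (\<Prod>k\<in>UNIV. x - l k)"
      by (subst det_diagonal) (auto simp: diag_matrix_def)
    finally show ?thesis by (simp add: poly_prod)
  qed
  then show ?thesis by (simp add: poly_eq_poly_eq_iff[symmetric] fun_eq_iff)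
qed

text \<open>This links the sorted roots in \<open>laplacian_eigenvalue\<close> to the family
  \<open>l\<close>, with multiplicities.\<close>

lemma proots_charpoly_spectral_matrix:
  assumes "orthogonal_matrix P"
  shows "proots (charpoly (spectral_matrix P l)) = image_mset l (mset_set UNIV)"
  by (simp add: charpoly_spectral_matrix[OF assms] proots_prod sum_unfold_sum_mset)

section \<open>Pseudoinverses and distances in a spectral basis\<close>

text \<open>The definite description needs uniqueness. For two solutions, \<open>A ** X\<close> and
  \<open>A ** Y\<close> absorb each other; being symmetric, they coincide. The same holds on the
  other side, and then Y = Y A Y = X A Y = X A X = X.\<close>

lemma pinv_eqI:
  fixes A :: "real^'n^'m"
  assumes "A ** X ** A = A" "X ** A ** X = X"
    "transpose (A ** X) = A ** X" "transpose (X ** A) = X ** A"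
  shows "pinv A = X"
  unfolding pinv_def
proof (rule the_equality)
  fix Y assume Y: "A ** Y ** A = A \<and> Y ** A ** Y = Y \<and>
     transpose (A ** Y) = A ** Y \<and> transpose (Y ** A) = Y ** A"
  have "A ** X = A ** Y"
  proof -
    have "A ** X = transpose (A ** Y ** (A ** X))"
      using Y assms by (simp add: matrix_mul_assoc)
    also have "\<dots> = A ** X ** (A ** Y)"
      using Y assms(3) by (simp only: matrix_transpose_mul)
    finally show ?thesis using assms(1) by (simp add: matrix_mul_assoc)
  qed
  moreover have "X ** A = Y ** A"
  proof -
    have "X ** A = transpose (X ** A ** (Y ** A))"
      using Y assms by (metis matrix_mul_assoc)
    also have "\<dots> = Y ** A ** (X ** A)"
      using Y assms(4) by (simp only: matrix_transpose_mul)
    also have "\<dots> = Y ** A" using assms(1) by (metis matrix_mul_assoc)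
    finally show ?thesis .
  qed
  ultimately show "Y = X"
    using Y assms(2) by (metis matrix_mul_assoc)
qed (use assms in simp)

lemma pinv_spectral_matrix:
  assumes "orthogonal_matrix P"
  shows "pinv (spectral_matrix P l) = spectral_matrix P (\<lambda>k. inverse (l k))"
proof -
  have "l k * inverse (l k) * l k = l k" "inverse (l k) * l k * inverse (l k) = inverse (l k)" for k
    by (cases "l k = 0"; simp)+
  then show ?thesis
    by (intro pinv_eqI) (simp_all only: spectral_matrix_mult[OF assms] transpose_spectral_matrix)
qed

text \<open>The coordinates of \<open>x\<close> in the eigenbasis are its inner products with the
  columns of \<open>P\<close>. The main use is at the all-ones vector.\<close>

lemma spectral_matrix_quadratic_form:
  "inner x (spectral_matrix P l *v x) = (\<Sum>k\<in>UNIV. l k * (inner x (column k P))\<^sup>2)"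
proof -
  have "inner x (spectral_matrix P l *v x) = inner (x v* P) (diag_matrix l *v (transpose P *v x))"
    by (simp only: spectral_matrix_def dot_lmul_matrix matrix_vector_mul_assoc matrix_mul_assoc)
  also have "transpose P *v x = x v* P"
    by (simp only: vector_transpose_matrix[symmetric] transpose_transpose)
  also have "x v* P = (\<chi> k. inner x (column k P))"
    by (simp add: vec_eq_iff vector_matrix_mult_def inner_vec_def column_def mult.commute)
  finally show ?thesis
    by (simp add: inner_vec_def[of "_ :: real^_" "diag_matrix _ *v _"] diag_matrix_mult_vector
        power2_eq_square mult_ac)
qed

text \<open>Eigenvectors for \<open>l k \<noteq> 0\<close> are orthogonal to the all-ones vector, and \<open>a\<close> kills the others.\<close>

lemma sum_distances_spectral_matrix:
  fixes P M :: "real^'n^'n" and a :: "'n \<Rightarrow> real"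
  assumes P: "orthogonal_matrix P" and ker: "spectral_matrix P l *v 1 = 0"
    and a: "\<And>k. l k = 0 \<Longrightarrow> a k = 0"
  defines "M \<equiv> spectral_matrix P a"
  shows "(\<Sum>u\<in>UNIV. \<Sum>v\<in>UNIV. M $ u $ u + M $ v $ v - 2 * M $ u $ v) = 2 * CARD('n) * sum a UNIV"
proof -
  have "a k * (inner 1 (column k P))\<^sup>2 = 0" for k
  proof (cases "l k = 0")
    case False
    have "l k * inner 1 (column k P) = inner 1 (spectral_matrix P l *v column k P)"
      by (simp add: spectral_matrix_mult_column[OF P])
    also have "\<dots> = inner (spectral_matrix P l *v 1) (column k P)"
      by (metis dot_lmul_matrix transpose_spectral_matrix vector_transpose_matrix)
    finally show ?thesis using ker False by simp
  qed (simp add: a)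
  then have "inner 1 (M *v 1) = 0"
    by (simp only: M_def spectral_matrix_quadratic_form sum.neutral_const)
  \<comment> \<open>The form at the all-ones vector is the sum of all entries. What remains are the
    two diagonal terms, each giving \<open>CARD('n)\<close> times the trace.\<close>
  then have "(\<Sum>u\<in>UNIV. \<Sum>v\<in>UNIV. M $ u $ v) = 0"
    by (simp add: inner_vec_def matrix_vector_mult_def)
  then show ?thesis
    using trace_spectral_matrix[OF P, of a]
    by (simp add: M_def[symmetric] trace_def sum.distrib sum_subtractf flip: sum_distrib_left)
qed

text \<open>Squaring undoes the square root only for a nonnegative radicand; here it is a weighted
  sum of squares of differences of eigenvector entries.\<close>

lemma biharmonic_distance_squared:
  fixes P Q :: "real^'v^'v"
  assumes P: "orthogonal_matrix P" and L: "laplacian G = spectral_matrix P l"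
  defines "Q \<equiv> spectral_matrix P (\<lambda>k. (inverse (l k))\<^sup>2)"
  shows "(biharmonic_distance G u v)\<^sup>2 = Q $ u $ u + Q $ v $ v - 2 * Q $ u $ v"
proof -
  have "Q $ u $ u + Q $ v $ v - 2 * Q $ u $ v
      = (\<Sum>k\<in>UNIV. (inverse (l k))\<^sup>2 * (P $ u $ k - P $ v $ k)\<^sup>2)"
    by (simp add: Q_def spectral_matrix_nth sum_distrib_left power2_eq_square algebra_simps
        flip: sum.distrib sum_subtractf)
  then have "Q $ u $ u + Q $ v $ v - 2 * Q $ u $ v \<ge> 0"
    by (simp add: sum_nonneg)
  then show ?thesis
    by (simp add: biharmonic_distance_def L pinv_spectral_matrix[OF P] spectral_matrix_mult[OF P]
        Q_def Let_def flip: power2_eq_square)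
qed

lemma kirchhoff_index_spectral:
  fixes P :: "real^'v^'v"
  assumes P: "orthogonal_matrix P" and L: "laplacian G = spectral_matrix P l"
    and ker: "laplacian G *v 1 = 0"
  shows "kirchhoff_index G = CARD('v) * (\<Sum>k\<in>UNIV. inverse (l k))"
  using sum_distances_spectral_matrix[OF P ker[unfolded L], of "\<lambda>k. inverse (l k)"]
  by (simp add: kirchhoff_index_def resistance_distance_def L pinv_spectral_matrix[OF P] Let_def)

lemma biharmonic_index_spectral:
  fixes P :: "real^'v^'v"
  assumes P: "orthogonal_matrix P" and L: "laplacian G = spectral_matrix P l"
    and ker: "laplacian G *v 1 = 0"
  shows "biharmonic_index G = CARD('v) * (\<Sum>k\<in>UNIV. (inverse (l k))\<^sup>2)"
  using sum_distances_spectral_matrix[OF P ker[unfolded L], of "\<lambda>k. (inverse (l k))\<^sup>2"]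
  by (simp add: biharmonic_index_def biharmonic_distance_squared[OF P L])

section \<open>The spectrum of the Laplacian\<close>

text \<open>Without parallel arcs, \<open>head G\<close> is injective on the arcs leaving
  \<open>u\<close>, so counting arcs amounts to counting neighbours.\<close>

lemma out_degree_eq_sum_adjacency:
  assumes "Digraph.graph G"
  shows "real (out_degree G u) = (\<Sum>v\<in>UNIV. adjacency_matrix G $ u $ v)"
proof -
  interpret graph G by fact
  have "inj_on (head G) (out_arcs G u)"
    using no_multi_arcs by (auto simp: inj_on_def arc_to_ends_def)
  moreover have "head G ` out_arcs G u = {v. (u, v) \<in> arcs_ends G}"
    by (auto simp: arcs_ends_conv image_iff)
  ultimately have "out_degree G u = card {v. (u, v) \<in> arcs_ends G}"
    unfolding out_degree_def by (metis card_image)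
  then show ?thesis
    by (simp add: adjacency_matrix_def sum.If_cases)
qed

lemma adjacency_matrix_sym:
  assumes "Digraph.graph G"
  shows "adjacency_matrix G $ u $ v = adjacency_matrix G $ v $ u"
proof -
  interpret graph G by fact
  show ?thesis using sym_arcs by (auto simp: adjacency_matrix_def symmetric_def sym_def)
qed

section \<open>The Laplacian as difference operator and quadratic form\<close>

lemma laplacian_mult_vector_nth:
  assumes "Digraph.graph G"
  shows "(laplacian G *v x) $ u = (\<Sum>v\<in>UNIV. adjacency_matrix G $ u $ v * (x $ u - x $ v))"
proof -
  have "(laplacian G *v x) $ u = real (out_degree G u) * x $ u - (\<Sum>v\<in>UNIV. adjacency_matrix G $ u $ v * x $ v)"
    by (simp add: laplacian_def degree_matrix_def matrix_vector_mult_def left_diff_distrib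
        sum_subtractf mult_delta_left)
  then show ?thesis
    by (simp add: out_degree_eq_sum_adjacency[OF assms] right_diff_distrib sum_subtractf sum_distrib_right)
qed

lemma transpose_laplacian:
  assumes "Digraph.graph G"
  shows "transpose (laplacian G) = laplacian G"
  using adjacency_matrix_sym[OF assms]
  by (simp add: vec_eq_iff transpose_def laplacian_def degree_matrix_def)

lemma laplacian_mult_one:
  assumes "Digraph.graph G"
  shows "laplacian G *v 1 = 0"
  by (simp add: vec_eq_iff laplacian_mult_vector_nth[OF assms])

text \<open>Averaging over both orientations of each edge turns x_u (x_u - x_v) into half a square.
  The factor 2 appears because the double sum meets every edge twice.\<close>

lemma laplacian_quadratic_form:
  assumes "Digraph.graph G"
  shows "2 * inner x (laplacian G *v x)
    = (\<Sum>u\<in>UNIV. \<Sum>v\<in>UNIV. adjacency_matrix G $ u $ v * (x $ u - x $ v)\<^sup>2)"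
proof -
  let ?a = "\<lambda>u v. adjacency_matrix G $ u $ v"
  have eq: "inner x (laplacian G *v x) = (\<Sum>u\<in>UNIV. \<Sum>v\<in>UNIV. ?a u v * (x $ u * (x $ u - x $ v)))"
    by (simp add: inner_vec_def laplacian_mult_vector_nth[OF assms] sum_distrib_left mult_ac)
  also have "\<dots> = (\<Sum>u\<in>UNIV. \<Sum>v\<in>UNIV. ?a u v * (x $ v * (x $ v - x $ u)))"
    by (subst sum.swap) (simp add: adjacency_matrix_sym[OF assms])
  finally have "2 * inner x (laplacian G *v x)
     = (\<Sum>u\<in>UNIV. \<Sum>v\<in>UNIV. ?a u v * (x $ u * (x $ u - x $ v)))
     + (\<Sum>u\<in>UNIV. \<Sum>v\<in>UNIV. ?a u v * (x $ v * (x $ v - x $ u)))"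
    using eq by simp
  then show ?thesis
    by (simp add: power2_eq_square algebra_simps flip: sum.distrib)
qed

lemma laplacian_quadratic_form_nonneg:
  assumes "Digraph.graph G"
  shows "inner x (laplacian G *v x) \<ge> 0"
proof -
  have "2 * inner x (laplacian G *v x) \<ge> 0"
    unfolding laplacian_quadratic_form[OF assms]
    by (intro sum_nonneg) (simp add: adjacency_matrix_def)
  then show ?thesis by simp
qed

text \<open>On the kernel the quadratic form vanishes, hence so does each of its nonnegative terms.
  Thus \<open>x\<close> agrees across every edge, and connectedness carries this along
  walks.\<close>

lemma laplacian_kernel_const:
  assumes G: "Digraph.graph G" "verts G = UNIV" "Digraph_Component.connected G"
    and "laplacian G *v x = 0"
  shows "x $ u = x $ v"
proof -
  interpret graph G by fact
  have "(\<Sum>u\<in>UNIV. \<Sum>v\<in>UNIV. adjacency_matrix G $ u $ v * (x $ u - x $ v)\<^sup>2) = 0"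
    using laplacian_quadratic_form[OF G(1), of x] assms(4) by simp
  then have *: "adjacency_matrix G $ u $ v * (x $ u - x $ v)\<^sup>2 = 0" for u v
    by (simp add: sum_nonneg_eq_0_iff sum_nonneg adjacency_matrix_def)
  then have edge: "x $ u = x $ v" if "(u, v) \<in> arcs_ends G" for u v
    using *[of u v] that by (simp add: adjacency_matrix_def)
  have "u \<rightarrow>\<^sup>*\<^bsub>G\<^esub> v"
    using symmetric_connected_imp_strongly_connected[OF sym_arcs G(3)] G(2)
    by (auto simp: strongly_connected_def)
  then show ?thesis
    by (induction rule: reachable_induct) (use edge in auto)
qed

text \<open>Eigenvalues are nonnegative by the quadratic form, zero occurs because of the all-ones
  vector, and it is simple because two orthogonal unit vectors cannot both be constant.\<close>

lemma laplacian_spectrum: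
  fixes P :: "real^'v^'v"
  assumes G: "Digraph.graph G" "verts G = UNIV" "Digraph_Component.connected G"
    and P: "orthogonal_matrix P" and L: "laplacian G = spectral_matrix P l"
  obtains k0 where "l k0 = 0" "\<And>k. k \<noteq> k0 \<Longrightarrow> l k > 0"
proof -
  have eig: "laplacian G *v column k P = l k *\<^sub>R column k P" for k
    unfolding L by (rule spectral_matrix_mult_column[OF P])
  have norm: "inner (column k P) (column k P) = 1" for k
    using P by (simp add: orthogonal_matrix_orthonormal_columns norm_eq_1)
  have nonneg: "l k \<ge> 0" for k
    using laplacian_quadratic_form_nonneg[OF G(1), of "column k P"] norm by (simp add: eig)
  have "\<exists>k. l k = 0"
  proof (rule ccontr)
    assume "\<nexists>k. l k = 0"
    \<comment> \<open>If every eigenvalue were positive, this would make the all-ones vector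
      orthogonal to a whole basis, hence zero.\<close>
    moreover have "(\<Sum>k\<in>UNIV. l k * (inner 1 (column k P))\<^sup>2) = 0"
      using laplacian_mult_one[OF G(1)] by (simp add: L flip: spectral_matrix_quadratic_form)
    ultimately have "inner 1 (column k P) = 0" for k
      using nonneg by (simp add: sum_nonneg_eq_0_iff)
    then have "1 v* P = 0"
      by (simp add: vec_eq_iff vector_matrix_mult_def inner_vec_def column_def)
    then have "1 v* (P ** transpose P) = 0"
      by (simp flip: vector_matrix_mul_assoc)
    then have "(1 :: real^'v) = 0"
      using P by (simp add: orthogonal_matrix_def)
    then show False by (simp add: vec_eq_iff)
  qed
  then obtain k0 where k0: "l k0 = 0" by blast
  have "l k \<noteq> 0" if "k \<noteq> k0" for k
  proof
    assume "l k = 0"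
    have const: "\<exists>c. column j P = c *\<^sub>R 1" if "l j = 0" for j
      using laplacian_kernel_const[OF G, of "column j P"] that eig[of j]
      \<comment> \<open>\<open>undefined\<close> is an arbitrary vertex; all entries of the column
        are equal.\<close>
      by (intro exI[of _ "column j P $ undefined"]) (simp add: vec_eq_iff)
    obtain c d where cd: "column k P = c *\<^sub>R 1" "column k0 P = d *\<^sub>R 1"
      using const[OF \<open>l k = 0\<close>] const[OF k0] by blast
    then have "c \<noteq> 0" "d \<noteq> 0" using norm[of k] norm[of k0] by auto
    moreover have "inner (column k P) (column k0 P) = 0"
      using P that by (simp add: orthogonal_matrix_orthonormal_columns orthogonal_def)
    ultimately show False by (simp add: cd inner_vec_def)
  qed
  with k0 nonneg that show ?thesis by (metis order_less_le)
qed

text \<open>The simple eigenvalue 0 sorts first, leaving the positive ones at positions 2 to n. The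
  last claim converts sums over the unordered family into sums over sorted eigenvalues;
  \<open>f 0 = 0\<close> removes the kernel term.\<close>

lemma laplacian_eigenvalue_spectral:
  fixes P :: "real^'v^'v"
  assumes G: "Digraph.graph G" "verts G = UNIV" "Digraph_Component.connected G"
    and P: "orthogonal_matrix P" and L: "laplacian G = spectral_matrix P l"
  shows "\<And>i j. \<lbrakk>2 \<le> i; i \<le> j; j \<le> CARD('v)\<rbrakk> \<Longrightarrow> laplacian_eigenvalue G i \<le> laplacian_eigenvalue G j"
    and "\<And>i. \<lbrakk>2 \<le> i; i \<le> CARD('v)\<rbrakk> \<Longrightarrow> laplacian_eigenvalue G i > 0"
    and "\<And>f :: real \<Rightarrow> real. f 0 = 0 \<Longrightarrow> (\<Sum>k\<in>UNIV. f (l k)) = (\<Sum>i=2..CARD('v). f (laplacian_eigenvalue G i))"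
proof -
  obtain k0 where k0: "l k0 = 0" and pos: "\<And>k. k \<noteq> k0 \<Longrightarrow> l k > 0"
    using laplacian_spectrum[OF G P L] by blast
  define M where "M = image_mset l (mset_set (UNIV - {k0}))"
  define ys where "ys = sorted_list_of_multiset M"
  have M: "image_mset l (mset_set UNIV) = add_mset 0 M"
    using k0 by (simp add: M_def mset_set.remove[of UNIV k0])
  have ys_pos: "x > 0" if "x \<in> set ys" for x
    using that pos by (auto simp: ys_def M_def)
  have ys: "sorted ys" "mset ys = M" by (simp_all add: ys_def)
  have len: "length ys = CARD('v) - 1"
    using arg_cong[OF ys(2), of size] by (simp add: M_def)
  have "sorted_list_of_multiset (add_mset 0 M) = 0 # ys"
    using ys_pos by (simp add: ys_def[symmetric] insort_is_Cons less_imp_le)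
  \<comment> \<open>The shift by 2 combines numbering from 1 with the leading 0, which is absent
    from \<open>ys\<close>.\<close>
  then have nth: "laplacian_eigenvalue G i = ys ! (i - 2)" if "i \<ge> 2" for i
    using that by (simp add: laplacian_eigenvalue_def L proots_charpoly_spectral_matrix[OF P] M
        nth_Cons' numeral_2_eq_2)
  show "laplacian_eigenvalue G i \<le> laplacian_eigenvalue G j" if "2 \<le> i" "i \<le> j" "j \<le> CARD('v)" for i j
    using that ys(1) len by (auto simp: nth intro!: sorted_nth_mono)
  show "laplacian_eigenvalue G i > 0" if "2 \<le> i" "i \<le> CARD('v)" for i
    using that len by (auto simp: nth intro!: ys_pos nth_mem)
  show "(\<Sum>k\<in>UNIV. f (l k)) = (\<Sum>i=2..CARD('v). f (laplacian_eigenvalue G i))"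
    if "f 0 = 0" for f :: "real \<Rightarrow> real"
  proof -
    have "(\<Sum>k\<in>UNIV. f (l k)) = (\<Sum>x\<in>#add_mset 0 M. f x)"
      unfolding M[symmetric] by (simp add: sum_unfold_sum_mset multiset.map_comp comp_def)
    also have "\<dots> = sum_list (map f ys)"
      using that by (simp flip: ys(2) sum_mset_sum_list)
    also have "\<dots> = (\<Sum>j<CARD('v) - 1. f (ys ! j))"
      by (simp add: sum_list_sum_nth len atLeast0LessThan)
    also have "\<dots> = (\<Sum>i=2..CARD('v). f (laplacian_eigenvalue G i))"
      by (rule sum.reindex_bij_witness[of _ "\<lambda>i. i - 2" "\<lambda>j. j + 2"]) (auto simp: nth)
    finally show ?thesis .
  qed
qed

section \<open>The bound\<close>

text \<open>\<open>D\<close> is the gap in the bound after division by n. Its constant term is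
  spread over the n - 1 indices in \<open>{2..n}\<close>, giving a termwise nonnegative sum.\<close>

lemma sum_inverse_squares_le:
  fixes e :: "nat \<Rightarrow> real" and n :: nat
  assumes "n \<ge> 2"
    and mono: "\<And>i j. \<lbrakk>2 \<le> i; i \<le> j; j \<le> n\<rbrakk> \<Longrightarrow> e i \<le> e j"
    and pos: "\<And>i. \<lbrakk>2 \<le> i; i \<le> n\<rbrakk> \<Longrightarrow> e i > 0"
  defines "D \<equiv> (1 / e 2 + 1 / e n) * (\<Sum>i=2..n. inverse (e i)) - (real n - 1) * (1 / (e 2 * e n))
                - (\<Sum>i=2..n. (inverse (e i))\<^sup>2)"
  shows "D \<ge> 0"
    and "D = 0 \<longleftrightarrow> (\<exists>r\<in>{2..n}. (\<forall>i\<in>{2..r}. e i = e 2) \<and> (\<forall>i\<in>{r+1..n}. e i = e n))"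
proof -
  define t where "t i = (inverse (e 2) - inverse (e i)) * (inverse (e i) - inverse (e n))" for i
  have "(\<Sum>i=2..n. t i) = (\<Sum>i=2..n. (1 / e 2 + 1 / e n) * inverse (e i) - 1 / (e 2 * e n) - (inverse (e i))\<^sup>2)"
    by (rule sum.cong) (simp_all add: t_def algebra_simps power2_eq_square inverse_eq_divide)
  then have D: "D = (\<Sum>i=2..n. t i)"
    using \<open>n \<ge> 2\<close> by (simp add: D_def sum_subtractf of_nat_diff flip: sum_distrib_left)
  have t_nonneg: "t i \<ge> 0" if "i \<in> {2..n}" for i
    using that mono[of 2 i] mono[of i n] pos[of 2] pos[of i]
    unfolding t_def by (intro mult_nonneg_nonneg) (auto intro: le_imp_inverse_le)
  show "D \<ge> 0" unfolding D by (rule sum_nonneg) (rule t_nonneg)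
  have "D = 0 \<longleftrightarrow> (\<forall>i\<in>{2..n}. t i = 0)"
    unfolding D by (rule sum_nonneg_eq_0_iff) (use t_nonneg in auto)
  \<comment> \<open>A product vanishes exactly when one factor does, and inversion is
    injective.\<close>
  also have "\<dots> \<longleftrightarrow> (\<forall>i\<in>{2..n}. e i = e 2 \<or> e i = e n)"
    by (auto simp: t_def)
  also have "\<dots> \<longleftrightarrow> (\<exists>r\<in>{2..n}. (\<forall>i\<in>{2..r}. e i = e 2) \<and> (\<forall>i\<in>{r+1..n}. e i = e n))" (is "?two \<longleftrightarrow> ?R")
  proof
    assume two: ?two
    \<comment> \<open>Take the last index with the smallest value. Monotonicity fills in all earlier
      ones, and every later index must take the other value \<open>e n\<close>. For
      \<open>r = n\<close> the second block is empty.\<close>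
    define r where "r = Max {i \<in> {2..n}. e i = e 2}"
    have fin: "finite {i \<in> {2..n}. e i = e 2}" by simp
    have "2 \<in> {i \<in> {2..n}. e i = e 2}" using \<open>n \<ge> 2\<close> by simp
    then have "r \<in> {i \<in> {2..n}. e i = e 2}"
      unfolding r_def by (intro Max_in[OF fin]) blast
    then have r: "r \<in> {2..n}" "e r = e 2" by auto
    have "e i = e 2" if "i \<in> {2..r}" for i
      using that r mono[of 2 i] mono[of i r] by auto
    moreover have "e i = e n" if "i \<in> {r+1..n}" for i
    proof -
      have "i \<notin> {i \<in> {2..n}. e i = e 2}"
        using that Max_ge[OF fin, of i] by (fold r_def) force
      then show ?thesis using that two r by auto
    qed
    ultimately show ?R using r by blast
  next
    assume ?R
    then obtain r where "\<forall>i\<in>{2..r}. e i = e 2" "\<forall>i\<in>{r+1..n}. e i = e n" by blast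
    then show ?two by (metis Suc_eq_plus1 atLeastAtMost_iff not_less_eq_eq)
  qed
  finally show "D = 0 \<longleftrightarrow> ?R" .
qed

theorem theorem4p1:
  fixes G :: "('v::finite, 'e) pre_digraph" and n :: nat and ev :: "nat \<Rightarrow> real"
  assumes "Digraph.graph G" and "verts G = UNIV" and "Digraph_Component.connected G"
    and "n = card (verts G)" and "n \<ge> 2"
    and "ev = laplacian_eigenvalue G"
  shows "biharmonic_index G
           \<le> (1 / ev 2 + 1 / ev n) * kirchhoff_index G - real n * (real n - 1) * (1 / (ev 2 * ev n)) \<and>
         (biharmonic_index G
           = (1 / ev 2 + 1 / ev n) * kirchhoff_index G - real n * (real n - 1) * (1 / (ev 2 * ev n))
          \<longleftrightarrow> (\<exists>r\<in>{2..n}. (\<forall>i\<in>{2..r}. ev i = ev 2) \<and> (\<forall>i\<in>{r+1..n}. ev i = ev n)))"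
proof -
  have n: "n = CARD('v)" using assms(2,4) by simp
  obtain P l where P: "orthogonal_matrix P" and L: "laplacian G = spectral_matrix P l"
    using symmetric_matrix_spectral[OF transpose_laplacian[OF assms(1)]] by blast
  note spec = laplacian_eigenvalue_spectral[OF assms(1-3) P L, folded assms(6) n]
  note ker = laplacian_mult_one[OF assms(1)]
  let ?bound = "(1 / ev 2 + 1 / ev n) * kirchhoff_index G - real n * (real n - 1) * (1 / (ev 2 * ev n))"
  define D where "D = (1 / ev 2 + 1 / ev n) * (\<Sum>i=2..n. inverse (ev i)) - (real n - 1) * (1 / (ev 2 * ev n))
                - (\<Sum>i=2..n. (inverse (ev i))\<^sup>2)"
  \<comment> \<open>Both indices carry a factor n, as does the correction term; since n is positive,
    the sign and vanishing of the gap are those of \<open>D\<close>.\<close>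
  have "?bound - biharmonic_index G = n * D"
    unfolding kirchhoff_index_spectral[OF P L ker] biharmonic_index_spectral[OF P L ker] D_def
      n[symmetric] spec(3)[of inverse, simplified] spec(3)[of "\<lambda>x. (inverse x)\<^sup>2", simplified]
    by (simp add: algebra_simps)
  moreover have "D \<ge> 0"
    and "D = 0 \<longleftrightarrow> (\<exists>r\<in>{2..n}. (\<forall>i\<in>{2..r}. ev i = ev 2) \<and> (\<forall>i\<in>{r+1..n}. ev i = ev n))"
    using sum_inverse_squares_le[of n ev, OF assms(5) spec(1,2)] by (simp_all add: D_def)
  moreover have "real n > 0" using assms(5) by simp
  ultimately show ?thesis
    by (smt (verit) mult_eq_0_iff mult_nonneg_nonneg)
qed

end
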